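(* Let $G$ be a unique product group and let $R$ be a unital $G$-graded ring whose $G$-grading is fully component regular. The following assertions hold: (i) Every unit in $R$ is homogeneous; (ii) $R$ is a domain; (iii) Every idempotent in $R$ is trivial.
   Context: A group $G$ is a unique product group if, given any two non-empty finite subsets $A$ and $B$ of $G$, there exists at least one element $g\in G$ which has a unique representation of the form $g=ab$ with $a\in A$ and $b\in B$. Rings are associative, not necessarily commutative; a unital ring here satisfies $1_R\neq 0$. A ring $R$ is $G$-graded if there is a collection $\{R_g\}_{g\in G}$ of additive subgroups of $R$ such that $R=\oplus_{g\in G}R_g$ and $R_gR_h\subseteq R_{gh}$ for all $g,h\in G$. A nonzero element of $R$ is homogeneous if it belongs to $R_g$ for some $g\in G$. The $G$-grading is fully component regular if $r_gs_h\neq 0$ for any $g,h\in G$, $r_g\in R_g\setminus\{0\}$ and $s_h\in R_h\setminus\{0\}$. A domain is a nonzero (not necessarily commutative) ring in which the product of any two nonzero elements is nonzero. An idempotent is trivial if it equals $0$ or $1_R$. *)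

theory Defs
  imports "HOL-Algebra.Algebra"
begin

locale unique_product_group = group +
  assumes unique_product:
    "\<lbrakk> A \<subseteq> carrier G; finite A; A \<noteq> {}; B \<subseteq> carrier G; finite B; B \<noteq> {} \<rbrakk>
      \<Longrightarrow> \<exists>g\<in>carrier G. \<exists>!p. p \<in> A \<times> B \<and> g = fst p \<otimes> snd p"

text \<open>
  A family of additive subgroups \<open>S i\<close>, for \<open>i \<in> I\<close>, has internal direct sum \<open>R\<close> if every element of
  \<open>R\<close> is in exactly one way the sum of a finitely supported choice of elements of the \<open>S i\<close>.
  The sum is taken over the support because \<^const>\<open>finsum\<close> is zero on infinite index sets; the
  functions are extensional, so that uniqueness only concerns values on \<open>I\<close>.
\<close>

definition internal_direct_sum :: "('r, 'm) ring_scheme \<Rightarrow> 'i set \<Rightarrow> ('i \<Rightarrow> 'r set) \<Rightarrow> bool" where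
  "internal_direct_sum R I S \<longleftrightarrow>
    (\<forall>i\<in>I. additive_subgroup (S i) R) \<and>
    (\<forall>r\<in>carrier R. \<exists>!f. f \<in> (\<Pi>\<^sub>E i\<in>I. S i) \<and> finite {i \<in> I. f i \<noteq> \<zero>\<^bsub>R\<^esub>} \<and>
        r = (\<Oplus>\<^bsub>R\<^esub>i\<in>{i \<in> I. f i \<noteq> \<zero>\<^bsub>R\<^esub>}. f i))"

text \<open>
  \<^locale>\<open>ring\<close> already requires an identity element, but permits \<open>\<one> = \<zero>\<close>. The product of the two
  components is the elementwise one; as \<open>S (g \<otimes> h)\<close> is closed under addition, the inclusion is the
  same as for the additive subgroup generated by the products.
\<close>

locale graded_ring = G: group G + R: ring R
  for G :: "('g, 'm) monoid_scheme" and R :: "('r, 'n) ring_scheme" and S :: "'g \<Rightarrow> 'r set" +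
  assumes direct_sum: "internal_direct_sum R (carrier G) S"
    and mult_components:
      "\<lbrakk> g \<in> carrier G; h \<in> carrier G \<rbrakk> \<Longrightarrow> S g <#>\<^bsub>R\<^esub> S h \<subseteq> S (g \<otimes>\<^bsub>G\<^esub> h)"

definition homogeneous ::
  "('g, 'm) monoid_scheme \<Rightarrow> ('r, 'n) ring_scheme \<Rightarrow> ('g \<Rightarrow> 'r set) \<Rightarrow> 'r \<Rightarrow> bool" where
  "homogeneous G R S r \<longleftrightarrow> r \<noteq> \<zero>\<^bsub>R\<^esub> \<and> (\<exists>g\<in>carrier G. r \<in> S g)"

definition fully_component_regular ::
  "('g, 'm) monoid_scheme \<Rightarrow> ('r, 'n) ring_scheme \<Rightarrow> ('g \<Rightarrow> 'r set) \<Rightarrow> bool" where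
  "fully_component_regular G R S \<longleftrightarrow>
    (\<forall>g\<in>carrier G. \<forall>h\<in>carrier G. \<forall>r\<in>S g - {\<zero>\<^bsub>R\<^esub>}. \<forall>s\<in>S h - {\<zero>\<^bsub>R\<^esub>}. r \<otimes>\<^bsub>R\<^esub> s \<noteq> \<zero>\<^bsub>R\<^esub>)"

text \<open>The library's \<^locale>\<open>domain\<close> is commutative, hence a separate notion.\<close>

locale noncomm_domain = ring +
  assumes nonzero_ring: "carrier R \<noteq> {\<zero>}"
    and mult_nonzero:
      "\<lbrakk> a \<in> carrier R; b \<in> carrier R; a \<noteq> \<zero>; b \<noteq> \<zero> \<rbrakk> \<Longrightarrow> a \<otimes> b \<noteq> \<zero>"

end

theory Submission
  imports Defs
begin

text \<open>
  Every element \<open>r\<close> is a finite sum of homogeneous components \<open>r\<^sub>g\<close>, and the components of a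
  product are given by convolution. If \<open>g\<close> and \<open>h\<close> are degrees occurring in \<open>r\<close> and \<open>s\<close> and the
  product \<open>g h\<close> arises from no other pair of such degrees, nothing can cancel: the degree-\<open>g h\<close>
  component of \<open>r s\<close> is the single term \<open>r\<^sub>g s\<^sub>h\<close>, which is nonzero by full component regularity.
  For nonzero \<open>r\<close> and \<open>s\<close> the unique product property supplies such a pair, so \<open>R\<close> is a domain, and
  an idempotent \<open>e\<close> is trivial because \<open>e (e - \<one>) = \<zero>\<close>.

  For units one unique product is not enough. By a theorem of Strojnowski, a unique product group
  yields at least two uniquely represented products in \<open>A B\<close>, for finite non-empty sets, as soon as \<open>A\<close> or \<open>B\<close> has more than one
  element (\<open>lone_unique_product_pair_imp_singletons\<close> is the contrapositive). If \<open>u v = \<one>\<close>, then each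
  uniquely represented product of the supports of \<open>u\<close> and \<open>v\<close> is a degree occurring in \<open>\<one>\<close>. As \<open>\<one>\<close>
  lies in the component of the neutral element (\<open>one_in_S_one\<close>), there is only one such product,
  and the support of \<open>u\<close> is a singleton.
\<close>

section \<open>Unique products\<close>

definition unique_product_pair :: "('g, 'm) monoid_scheme \<Rightarrow> 'g set \<Rightarrow> 'g set \<Rightarrow> 'g \<Rightarrow> 'g \<Rightarrow> bool" where
  "unique_product_pair G A B a b \<longleftrightarrow> a \<in> A \<and> b \<in> B \<and>
    (\<forall>a'\<in>A. \<forall>b'\<in>B. a' \<otimes>\<^bsub>G\<^esub> b' = a \<otimes>\<^bsub>G\<^esub> b \<longrightarrow> a' = a \<and> b' = b)"

context unique_product_group
begin

lemma ex_unique_product_pair: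
  assumes "A \<subseteq> carrier G" "finite A" "A \<noteq> {}" "B \<subseteq> carrier G" "finite B" "B \<noteq> {}"
  obtains a b where "unique_product_pair G A B a b"
proof -
  obtain g where "\<exists>!p. p \<in> A \<times> B \<and> g = fst p \<otimes> snd p"
    using unique_product[OF assms] by blast
  then obtain p where p: "p \<in> A \<times> B" "g = fst p \<otimes> snd p"
    and uniq: "\<And>q. q \<in> A \<times> B \<Longrightarrow> g = fst q \<otimes> snd q \<Longrightarrow> q = p"
    by metis
  have "unique_product_pair G A B (fst p) (snd p)"
    unfolding unique_product_pair_def
  proof (intro conjI ballI impI)
    fix a b assume "a \<in> A" "b \<in> B" "a \<otimes> b = fst p \<otimes> snd p"
    then have "(a, b) = p" using p(2) by (intro uniq) auto
    then show "a = fst p" "b = snd p" by auto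
  qed (use p in auto)
  then show thesis by (rule that)
qed

text \<open>
  Strojnowski's trick: apply the unique product property not to \<open>A\<close> and \<open>B\<close> but to
  \<open>C = B\<^sup>-\<^sup>1 a\<^sub>0\<^sup>-\<^sup>1 A\<close> and \<open>D = B b\<^sub>0\<^sup>-\<^sup>1 A\<^sup>-\<^sup>1\<close>. In a uniquely represented product
  \<open>(b\<^sub>1\<^sup>-\<^sup>1 a\<^sub>0\<^sup>-\<^sup>1 a\<^sub>1) (b\<^sub>2 b\<^sub>0\<^sup>-\<^sup>1 a\<^sub>2\<^sup>-\<^sup>1)\<close> any other factorisation of the inner product \<open>a\<^sub>1 b\<^sub>2\<close> in \<open>A B\<close> would
  give a second representation, so \<open>(a\<^sub>1, b\<^sub>2) = (a\<^sub>0, b\<^sub>0)\<close>. What remains is \<open>(a\<^sub>2 b\<^sub>1)\<^sup>-\<^sup>1\<close>, and the same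
  argument gives \<open>(a\<^sub>2, b\<^sub>1) = (a\<^sub>0, b\<^sub>0)\<close>. Hence \<open>b\<^sub>0\<^sup>-\<^sup>1 a\<^sub>0\<^sup>-\<^sup>1\<close> is uniquely represented; but it is also
  \<open>(b\<^sub>0\<^sup>-\<^sup>1 a\<^sub>0\<^sup>-\<^sup>1 a) a\<^sup>-\<^sup>1\<close> for each \<open>a \<in> A\<close> and \<open>b\<^sup>-\<^sup>1 (b b\<^sub>0\<^sup>-\<^sup>1 a\<^sub>0\<^sup>-\<^sup>1)\<close> for each \<open>b \<in> B\<close>.
\<close>

lemma lone_unique_product_pair_imp_singletons:
  assumes A: "A \<subseteq> carrier G" "finite A" and B: "B \<subseteq> carrier G" "finite B"
    and ab: "a0 \<in> A" "b0 \<in> B"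
    and lone: "\<And>a b. unique_product_pair G A B a b \<Longrightarrow> a = a0 \<and> b = b0"
  shows "A = {a0}" and "B = {b0}"
proof -
  define c where "c = (\<lambda>b a. inv b \<otimes> (inv a0 \<otimes> a))"
  define d where "d = (\<lambda>b a. b \<otimes> inv b0 \<otimes> inv a)"
  define C where "C = case_prod c ` (B \<times> A)"
  define D where "D = case_prod d ` (B \<times> A)"
  have a0: "a0 \<in> carrier G" and b0: "b0 \<in> carrier G"
    using ab A B by auto
  have in_G: "a \<in> A \<Longrightarrow> a \<in> carrier G" "b \<in> B \<Longrightarrow> b \<in> carrier G" for a b
    using A B by auto
  have cC: "c b a \<in> C" and dD: "d b a \<in> D" if "a \<in> A" "b \<in> B" for a b
    using that by (auto simp: C_def D_def)
  have "C \<subseteq> carrier G" "finite C" "C \<noteq> {}" "D \<subseteq> carrier G" "finite D" "D \<noteq> {}"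
    using A B ab a0 b0 by (auto simp: C_def D_def c_def d_def in_G)
  then obtain x y where xy: "unique_product_pair G C D x y"
    by (rule ex_unique_product_pair)
  then obtain a1 b1 a2 b2 where
    mem: "a1 \<in> A" "b1 \<in> B" "a2 \<in> A" "b2 \<in> B" and x: "x = c b1 a1" and y: "y = d b2 a2"
    by (auto simp: unique_product_pair_def C_def D_def)
  have uniq: "c b a = x \<and> d b' a' = y"
    if "a \<in> A" "b \<in> B" "a' \<in> A" "b' \<in> B" "c b a \<otimes> d b' a' = x \<otimes> y" for a b a' b'
    using xy that cC dD unfolding unique_product_pair_def by blast
  have cd: "c b a \<otimes> d b' a' = (inv b \<otimes> inv a0) \<otimes> (a \<otimes> b') \<otimes> (inv b0 \<otimes> inv a')"
    if "a \<in> A" "b \<in> B" "a' \<in> A" "b' \<in> B" for a b a' b'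
    using that a0 b0 by (simp add: c_def d_def m_assoc in_G)
  have "unique_product_pair G A B a1 b2"
    unfolding unique_product_pair_def
  proof (intro conjI ballI impI)
    fix a b assume ab': "a \<in> A" "b \<in> B" and eq: "a \<otimes> b = a1 \<otimes> b2"
    then have "c b1 a \<otimes> d b a2 = x \<otimes> y"
      using mem by (simp add: x y cd)
    then have "c b1 a = c b1 a1"
      using uniq ab' mem x by blast
    then show "a = a1"
      using a0 ab' mem by (simp add: c_def in_G)
    then show "b = b2"
      using eq ab' mem by (simp add: in_G)
  qed (use mem in auto)
  from lone[OF this] have inner: "a1 = a0" "b2 = b0"
    by simp_all
  have cd0: "c b a0 \<otimes> d b0 a = inv (a \<otimes> b)" if "a \<in> A" "b \<in> B" for a b
    using that a0 b0 by (simp add: c_def d_def inv_mult_group in_G)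
  have "unique_product_pair G A B a2 b1"
    unfolding unique_product_pair_def
  proof (intro conjI ballI impI)
    fix a b assume ab': "a \<in> A" "b \<in> B" and eq: "a \<otimes> b = a2 \<otimes> b1"
    then have "c b a0 \<otimes> d b0 a = x \<otimes> y"
      using mem by (simp add: x y inner cd0)
    then have "d b0 a = d b0 a2"
      using uniq ab' ab mem y inner by blast
    then have "inv a = inv a2"
      using b0 ab' mem by (simp add: d_def in_G)
    then show "a = a2"
      by (rule inj_onD[OF inv_inj]) (use ab' mem in_G in simp_all)
    then show "b = b1"
      using eq ab' mem by (simp add: in_G)
  qed (use mem in auto)
  from lone[OF this] have outer: "a2 = a0" "b1 = b0"
    by simp_all
  have x0: "x = inv b0" and y0: "y = inv a0"
    using a0 b0 by (simp_all add: x y inner outer c_def d_def)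
  have "a = a0" if a: "a \<in> A" for a
  proof -
    have "c b0 a \<otimes> d b0 a = x \<otimes> y"
      using a ab a0 b0 by (simp add: c_def d_def x0 y0 m_assoc in_G)
    then have "d b0 a = y"
      using uniq a ab by blast
    then have "inv a = inv a0"
      using a a0 b0 by (simp add: d_def y0 in_G)
    then show ?thesis
      by (rule inj_onD[OF inv_inj]) (use a a0 in_G in simp_all)
  qed
  then show "A = {a0}" using ab by blast
  have "b = b0" if b: "b \<in> B" for b
  proof -
    have "c b a0 \<otimes> d b a0 = x \<otimes> y"
      using b ab a0 b0 by (simp add: c_def d_def x0 y0 m_assoc[symmetric] in_G)
    then have "c b a0 = x"
      using uniq b ab by blast
    then have "inv b = inv b0"
      using b a0 b0 by (simp add: c_def x0 in_G)
    then show ?thesis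
      by (rule inj_onD[OF inv_inj]) (use b b0 in_G in simp_all)
  qed
  then show "B = {b0}" using ab by blast
qed

end

section \<open>Homogeneous components\<close>

context graded_ring
begin

definition component :: "'r \<Rightarrow> 'g \<Rightarrow> 'r" where
  "component r = (THE f. f \<in> (\<Pi>\<^sub>E g\<in>carrier G. S g) \<and>
     finite {g \<in> carrier G. f g \<noteq> \<zero>\<^bsub>R\<^esub>} \<and>
     r = (\<Oplus>\<^bsub>R\<^esub>g\<in>{g \<in> carrier G. f g \<noteq> \<zero>\<^bsub>R\<^esub>}. f g))"

definition support :: "'r \<Rightarrow> 'g set" where
  "support r = {g \<in> carrier G. component r g \<noteq> \<zero>\<^bsub>R\<^esub>}"

lemma additive_subgroup_S: "g \<in> carrier G \<Longrightarrow> additive_subgroup (S g) R"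
  using direct_sum by (simp add: internal_direct_sum_def)

lemma S_closed: "g \<in> carrier G \<Longrightarrow> x \<in> S g \<Longrightarrow> x \<in> carrier R"
  using additive_subgroup.a_Hcarr[OF additive_subgroup_S] .

lemma zero_in_S: "g \<in> carrier G \<Longrightarrow> \<zero>\<^bsub>R\<^esub> \<in> S g"
  using additive_subgroup.zero_closed[OF additive_subgroup_S] .

lemma S_mult: "g \<in> carrier G \<Longrightarrow> h \<in> carrier G \<Longrightarrow> x \<in> S g \<Longrightarrow> y \<in> S h \<Longrightarrow>
    x \<otimes>\<^bsub>R\<^esub> y \<in> S (g \<otimes>\<^bsub>G\<^esub> h)"
  using mult_components unfolding set_mult_def by blast

lemma
  assumes "r \<in> carrier R"
  shows component_PiE: "component r \<in> (\<Pi>\<^sub>E g\<in>carrier G. S g)"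
    and finite_support: "finite (support r)"
    and sum_components: "r = (\<Oplus>\<^bsub>R\<^esub>g\<in>support r. component r g)"
proof -
  have "\<exists>!f. f \<in> (\<Pi>\<^sub>E g\<in>carrier G. S g) \<and> finite {g \<in> carrier G. f g \<noteq> \<zero>\<^bsub>R\<^esub>} \<and>
        r = (\<Oplus>\<^bsub>R\<^esub>g\<in>{g \<in> carrier G. f g \<noteq> \<zero>\<^bsub>R\<^esub>}. f g)"
    using direct_sum assms by (simp add: internal_direct_sum_def)
  from theI'[OF this]
  show "component r \<in> (\<Pi>\<^sub>E g\<in>carrier G. S g)"
    and "finite (support r)"
    and "r = (\<Oplus>\<^bsub>R\<^esub>g\<in>support r. component r g)"
    by (simp_all add: component_def support_def)
qed

lemma component_in_S: "r \<in> carrier R \<Longrightarrow> g \<in> carrier G \<Longrightarrow> component r g \<in> S g"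
  using component_PiE by (auto dest: PiE_mem)

lemma component_closed: "r \<in> carrier R \<Longrightarrow> g \<in> carrier G \<Longrightarrow> component r g \<in> carrier R"
  by (rule S_closed[OF _ component_in_S])

lemma support_subset: "support r \<subseteq> carrier G"
  by (auto simp: support_def)

text \<open>
  The form in which uniqueness of the decomposition gets used: the index set may exceed the support
  and \<open>f\<close> need not be extensional.
\<close>

lemma component_eqI:
  assumes f: "f \<in> (\<Pi> g\<in>carrier G. S g)" and F: "finite F" "F \<subseteq> carrier G"
    and zero: "\<And>g. g \<in> carrier G - F \<Longrightarrow> f g = \<zero>\<^bsub>R\<^esub>"
    and r: "r = (\<Oplus>\<^bsub>R\<^esub>g\<in>F. f g)" and g: "g \<in> carrier G"
  shows "component r g = f g"
proof -
  let ?P = "\<lambda>f. f \<in> (\<Pi>\<^sub>E g\<in>carrier G. S g) \<and> finite {g \<in> carrier G. f g \<noteq> \<zero>\<^bsub>R\<^esub>} \<and>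
        r = (\<Oplus>\<^bsub>R\<^esub>g\<in>{g \<in> carrier G. f g \<noteq> \<zero>\<^bsub>R\<^esub>}. f g)"
  let ?f = "restrict f (carrier G)"
  have closed: "f h \<in> carrier R" if "h \<in> carrier G" for h
    using f that by (auto intro: S_closed)
  have sub: "{g \<in> carrier G. ?f g \<noteq> \<zero>\<^bsub>R\<^esub>} \<subseteq> F"
    using zero by force
  have "r = (\<Oplus>\<^bsub>R\<^esub>g\<in>{g \<in> carrier G. ?f g \<noteq> \<zero>\<^bsub>R\<^esub>}. ?f g)"
    unfolding r
    by (rule R.add.finprod_mono_neutral_cong_right[OF F(1) sub])
       (use F(2) closed in auto)
  then have "?P ?f"
    using f finite_subset[OF sub F(1)] by auto
  moreover have "r \<in> carrier R"
    unfolding r by (rule R.finsum_closed) (use F(2) closed in auto)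
  then have "\<exists>!f. ?P f"
    using direct_sum by (simp add: internal_direct_sum_def)
  ultimately have "component r = ?f"
    unfolding component_def by (intro the1_equality)
  then show ?thesis using g by simp
qed

lemma component_homogeneous:
  assumes "h \<in> carrier G" "x \<in> S h" "g \<in> carrier G"
  shows "component x g = (if g = h then x else \<zero>\<^bsub>R\<^esub>)"
  by (rule component_eqI[where F = "{h}"])
     (use assms zero_in_S in \<open>auto simp: S_closed\<close>)

lemma component_add:
  assumes r: "r \<in> carrier R" and s: "s \<in> carrier R" and g: "g \<in> carrier G"
  shows "component (r \<oplus>\<^bsub>R\<^esub> s) g = component r g \<oplus>\<^bsub>R\<^esub> component s g"
proof (rule component_eqI[where F = "support r \<union> support s"])
  show "(\<lambda>g. component r g \<oplus>\<^bsub>R\<^esub> component s g) \<in> Pi (carrier G) S"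
    using r s by (auto intro: additive_subgroup.a_closed[OF additive_subgroup_S] component_in_S)
  have extend: "t = (\<Oplus>\<^bsub>R\<^esub>g\<in>support r \<union> support s. component t g)"
    if "t \<in> carrier R" "support t \<subseteq> support r \<union> support s" for t
  proof -
    have sub: "support r \<union> support s \<subseteq> carrier G"
      using support_subset by auto
    then have "(\<Oplus>\<^bsub>R\<^esub>g\<in>support t. component t g) =
        (\<Oplus>\<^bsub>R\<^esub>g\<in>support r \<union> support s. component t g)"
    proof (intro R.add.finprod_mono_neutral_cong_left)
      show "component t g = \<zero>\<^bsub>R\<^esub>" if "g \<in> support r \<union> support s - support t" for g
        using that sub by (auto simp: support_def)
    qed (use that r s finite_support component_closed in auto)
    then show ?thesis
      using sum_components[OF that(1)] by simp
  qed
  have "(\<Oplus>\<^bsub>R\<^esub>g\<in>support r \<union> support s. component r g \<oplus>\<^bsub>R\<^esub> component s g) =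
      (\<Oplus>\<^bsub>R\<^esub>g\<in>support r \<union> support s. component r g) \<oplus>\<^bsub>R\<^esub> (\<Oplus>\<^bsub>R\<^esub>g\<in>support r \<union> support s. component s g)"
    by (rule R.finsum_addf) (use r s support_subset component_closed in auto)
  then show "r \<oplus>\<^bsub>R\<^esub> s =
      (\<Oplus>\<^bsub>R\<^esub>g\<in>support r \<union> support s. component r g \<oplus>\<^bsub>R\<^esub> component s g)"
    using extend[OF r] extend[OF s] by simp
qed (use r s g finite_support support_subset in \<open>auto simp: support_def\<close>)

lemma component_zero: "g \<in> carrier G \<Longrightarrow> component \<zero>\<^bsub>R\<^esub> g = \<zero>\<^bsub>R\<^esub>"
  using component_homogeneous[OF _ zero_in_S] by simp

lemma support_nonempty:
  assumes "r \<in> carrier R" "r \<noteq> \<zero>\<^bsub>R\<^esub>"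
  shows "support r \<noteq> {}"
  using sum_components[OF assms(1)] assms(2) by auto

lemma component_finsum:
  assumes "finite I" and "f \<in> I \<rightarrow> carrier R" and g: "g \<in> carrier G"
  shows "component (\<Oplus>\<^bsub>R\<^esub>i\<in>I. f i) g = (\<Oplus>\<^bsub>R\<^esub>i\<in>I. component (f i) g)"
  using assms(1,2)
proof (induction I)
  case empty
  then show ?case using g by (simp add: component_zero)
next
  case (insert i I)
  then have "component (f j) g \<in> carrier R" if "j \<in> insert i I" for j
    using that g by (auto intro: component_closed)
  with insert show ?case
    using g by (simp add: component_add Pi_iff)
qed

text \<open>
  Left multiplication by \<open>x \<in> S h\<close> shifts degrees by \<open>h\<close>; as \<open>G\<close> is a group the shift is a bijection,
  so no two components of \<open>s\<close> can merge.
\<close>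

lemma component_homogeneous_mult:
  assumes h: "h \<in> carrier G" and x: "x \<in> S h" and s: "s \<in> carrier R" and g: "g \<in> carrier G"
  shows "component (x \<otimes>\<^bsub>R\<^esub> s) g = x \<otimes>\<^bsub>R\<^esub> component s (inv\<^bsub>G\<^esub> h \<otimes>\<^bsub>G\<^esub> g)"
proof (rule component_eqI[where F = "(\<lambda>k. h \<otimes>\<^bsub>G\<^esub> k) ` support s"])
  let ?f = "\<lambda>g. x \<otimes>\<^bsub>R\<^esub> component s (inv\<^bsub>G\<^esub> h \<otimes>\<^bsub>G\<^esub> g)"
  have xR: "x \<in> carrier R"
    using S_closed h x .
  have shift: "inv\<^bsub>G\<^esub> h \<otimes>\<^bsub>G\<^esub> (h \<otimes>\<^bsub>G\<^esub> k) = k" "h \<otimes>\<^bsub>G\<^esub> (inv\<^bsub>G\<^esub> h \<otimes>\<^bsub>G\<^esub> k) = k" if "k \<in> carrier G" for k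
    using that h by (simp_all add: G.m_assoc[symmetric])
  show "?f \<in> Pi (carrier G) S"
  proof
    fix k assume k: "k \<in> carrier G"
    then have "?f k \<in> S (h \<otimes>\<^bsub>G\<^esub> (inv\<^bsub>G\<^esub> h \<otimes>\<^bsub>G\<^esub> k))"
      using h x s by (intro S_mult component_in_S) auto
    then show "?f k \<in> S k" using k by (simp add: shift)
  qed
  show "?f k = \<zero>\<^bsub>R\<^esub>" if k: "k \<in> carrier G - (\<lambda>k. h \<otimes>\<^bsub>G\<^esub> k) ` support s" for k
  proof -
    have "inv\<^bsub>G\<^esub> h \<otimes>\<^bsub>G\<^esub> k \<notin> support s"
      using k shift(2)[of k] by (metis DiffD1 DiffD2 imageI)
    then show ?thesis
      using k h xR by (simp add: support_def)
  qed
  have inj: "inj_on (\<lambda>k. h \<otimes>\<^bsub>G\<^esub> k) (support s)"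
    by (rule inj_on_inverseI[where g = "\<lambda>k. inv\<^bsub>G\<^esub> h \<otimes>\<^bsub>G\<^esub> k"]) (use support_subset shift in auto)
  have sub: "k \<in> carrier G" if "k \<in> support s" for k
    using that support_subset by auto
  have "x \<otimes>\<^bsub>R\<^esub> s = (\<Oplus>\<^bsub>R\<^esub>k\<in>support s. x \<otimes>\<^bsub>R\<^esub> component s k)"
    by (subst sum_components[OF s], rule R.finsum_rdistr)
       (use s xR sub component_closed finite_support in auto)
  also have "\<dots> = (\<Oplus>\<^bsub>R\<^esub>k\<in>support s. ?f (h \<otimes>\<^bsub>G\<^esub> k))"
    by (rule R.finsum_cong') (use s xR h sub shift component_closed in auto)
  also have "\<dots> = (\<Oplus>\<^bsub>R\<^esub>k\<in>(\<lambda>k. h \<otimes>\<^bsub>G\<^esub> k) ` support s. ?f k)"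
    by (rule R.finsum_reindex[symmetric, OF _ inj]) (use s xR h sub component_closed in auto)
  finally show "x \<otimes>\<^bsub>R\<^esub> s = (\<Oplus>\<^bsub>R\<^esub>k\<in>(\<lambda>k. h \<otimes>\<^bsub>G\<^esub> k) ` support s. ?f k)" .
qed (use h s g finite_support support_subset in auto)

lemma component_mult:
  assumes r: "r \<in> carrier R" and s: "s \<in> carrier R" and g: "g \<in> carrier G"
  shows "component (r \<otimes>\<^bsub>R\<^esub> s) g =
    (\<Oplus>\<^bsub>R\<^esub>h\<in>support r. component r h \<otimes>\<^bsub>R\<^esub> component s (inv\<^bsub>G\<^esub> h \<otimes>\<^bsub>G\<^esub> g))"
proof -
  have sub: "h \<in> carrier G" if "h \<in> support r" for h
    using that support_subset by auto
  have "r \<otimes>\<^bsub>R\<^esub> s = (\<Oplus>\<^bsub>R\<^esub>h\<in>support r. component r h \<otimes>\<^bsub>R\<^esub> s)"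
    by (subst sum_components[OF r], rule R.finsum_ldistr)
       (use r s sub component_closed finite_support in auto)
  then have "component (r \<otimes>\<^bsub>R\<^esub> s) g = (\<Oplus>\<^bsub>R\<^esub>h\<in>support r. component (component r h \<otimes>\<^bsub>R\<^esub> s) g)"
    using r s g sub component_closed finite_support by (simp add: component_finsum Pi_iff)
  also have "\<dots> = (\<Oplus>\<^bsub>R\<^esub>h\<in>support r. component r h \<otimes>\<^bsub>R\<^esub> component s (inv\<^bsub>G\<^esub> h \<otimes>\<^bsub>G\<^esub> g))"
    by (rule R.finsum_cong')
       (use r s g sub component_closed component_in_S component_homogeneous_mult in auto)
  finally show ?thesis .
qed

text \<open>
  Let \<open>e\<close> be the degree-\<open>\<one>\<close> component of the identity. Comparing components of degree \<open>g\<close> in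
  \<open>x = x \<otimes> \<one>\<close> for \<open>x \<in> S g\<close> gives \<open>x = x \<otimes> e\<close>. Summing this over the components \<open>x\<close> of the
  identity yields \<open>\<one> = \<one> \<otimes> e = e\<close>.
\<close>

lemma one_in_S_one: "\<one>\<^bsub>R\<^esub> \<in> S \<one>\<^bsub>G\<^esub>"
proof -
  let ?e = "component \<one>\<^bsub>R\<^esub> \<one>\<^bsub>G\<^esub>"
  have e: "?e \<in> carrier R"
    by (simp add: component_closed)
  have sub: "g \<in> carrier G" if "g \<in> support \<one>\<^bsub>R\<^esub>" for g
    using that support_subset by auto
  have right_id: "component \<one>\<^bsub>R\<^esub> g \<otimes>\<^bsub>R\<^esub> ?e = component \<one>\<^bsub>R\<^esub> g" if g: "g \<in> carrier G" for g
  proof -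
    let ?x = "component \<one>\<^bsub>R\<^esub> g"
    have "?x = component (?x \<otimes>\<^bsub>R\<^esub> \<one>\<^bsub>R\<^esub>) g"
      using g component_homogeneous[OF g component_in_S g] by (simp add: component_closed)
    also have "\<dots> = ?x \<otimes>\<^bsub>R\<^esub> ?e"
      using g by (simp add: component_homogeneous_mult[OF g component_in_S])
    finally show ?thesis by simp
  qed
  have "?e = \<one>\<^bsub>R\<^esub> \<otimes>\<^bsub>R\<^esub> ?e"
    using e by simp
  also have "\<dots> = (\<Oplus>\<^bsub>R\<^esub>g\<in>support \<one>\<^bsub>R\<^esub>. component \<one>\<^bsub>R\<^esub> g \<otimes>\<^bsub>R\<^esub> ?e)"
    by (subst sum_components[OF R.one_closed], rule R.finsum_ldistr)
       (use e sub component_closed finite_support in auto)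
  also have "\<dots> = (\<Oplus>\<^bsub>R\<^esub>g\<in>support \<one>\<^bsub>R\<^esub>. component \<one>\<^bsub>R\<^esub> g)"
    by (rule R.finsum_cong') (use sub right_id component_closed in auto)
  also have "\<dots> = \<one>\<^bsub>R\<^esub>"
    using sum_components[OF R.one_closed] by simp
  finally show ?thesis
    using component_in_S[OF R.one_closed G.one_closed] by simp
qed

lemma homogeneous_if_support_singleton:
  assumes r: "r \<in> carrier R" and g: "support r = {g}"
  shows "homogeneous G R S r"
proof -
  have gG: "g \<in> carrier G" and "component r g \<noteq> \<zero>\<^bsub>R\<^esub>"
    using g by (auto simp: support_def)
  moreover have "r = component r g"
    using sum_components[OF r] gG r by (simp add: g component_closed)
  ultimately show ?thesis
    using component_in_S[OF r gG] by (auto simp: homogeneous_def)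
qed

text \<open>
  Of the terms \<open>r\<^sub>k s\<^sub>l\<close> with \<open>k l = g h\<close> that make up the degree-\<open>g h\<close> component of a product, only
  the one with \<open>k = g\<close> and \<open>l = h\<close> survives.
\<close>

lemma component_mult_unique_product_pair:
  assumes r: "r \<in> carrier R" and s: "s \<in> carrier R"
    and gh: "unique_product_pair G (support r) (support s) g h"
  shows "component (r \<otimes>\<^bsub>R\<^esub> s) (g \<otimes>\<^bsub>G\<^esub> h) = component r g \<otimes>\<^bsub>R\<^esub> component s h"
proof -
  have g: "g \<in> support r" "g \<in> carrier G" and h: "h \<in> carrier G"
    using gh support_subset by (auto simp: unique_product_pair_def)
  have sub: "k \<in> carrier G" if "k \<in> support r" for k
    using that support_subset by auto
  have "component (r \<otimes>\<^bsub>R\<^esub> s) (g \<otimes>\<^bsub>G\<^esub> h) =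
      (\<Oplus>\<^bsub>R\<^esub>k\<in>support r. component r k \<otimes>\<^bsub>R\<^esub> component s (inv\<^bsub>G\<^esub> k \<otimes>\<^bsub>G\<^esub> (g \<otimes>\<^bsub>G\<^esub> h)))"
    using component_mult r s g h by simp
  also have "\<dots> = (\<Oplus>\<^bsub>R\<^esub>k\<in>{g}. component r k \<otimes>\<^bsub>R\<^esub> component s h)"
  proof (rule R.add.finprod_mono_neutral_cong_right)
    fix k assume k: "k \<in> support r - {g}"
    let ?l = "inv\<^bsub>G\<^esub> k \<otimes>\<^bsub>G\<^esub> (g \<otimes>\<^bsub>G\<^esub> h)"
    have kG: "k \<in> carrier G"
      using k sub by blast
    then have "k \<otimes>\<^bsub>G\<^esub> ?l = g \<otimes>\<^bsub>G\<^esub> h"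
      using g h by (simp add: G.m_assoc[symmetric])
    then have "?l \<notin> support s"
      using gh k by (auto simp: unique_product_pair_def)
    then have "component s ?l = \<zero>\<^bsub>R\<^esub>"
      using kG g h by (simp add: support_def)
    then show "component r k \<otimes>\<^bsub>R\<^esub> component s ?l = \<zero>\<^bsub>R\<^esub>"
      using kG r by (simp add: component_closed)
  qed (use g h r s sub in \<open>auto simp: finite_support component_closed G.m_assoc[symmetric]\<close>)
  also have "\<dots> = component r g \<otimes>\<^bsub>R\<^esub> component s h"
    using g h r s by (simp add: component_closed)
  finally show ?thesis .
qed

end

section \<open>Fully component regular gradings by unique product groups\<close>

locale fully_component_regular_graded_ring = graded_ring G R S + unique_product_group G
  for G :: "('g, 'm) monoid_scheme" and R :: "('r, 'n) ring_scheme" and S :: "'g \<Rightarrow> 'r set" +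
  assumes regular: "fully_component_regular G R S"
begin

lemma component_mult_nonzero:
  assumes r: "r \<in> carrier R" and s: "s \<in> carrier R"
    and gh: "unique_product_pair G (support r) (support s) g h"
  shows "component (r \<otimes>\<^bsub>R\<^esub> s) (g \<otimes>\<^bsub>G\<^esub> h) \<noteq> \<zero>\<^bsub>R\<^esub>"
proof -
  have "g \<in> support r" "h \<in> support s"
    using gh by (auto simp: unique_product_pair_def)
  then show ?thesis
    using r s regular
    unfolding component_mult_unique_product_pair[OF assms] fully_component_regular_def support_def
    by (auto simp: component_in_S)
qed

lemma ex_unique_product_pair_supports:
  assumes "r \<in> carrier R" "s \<in> carrier R" "r \<noteq> \<zero>\<^bsub>R\<^esub>" "s \<noteq> \<zero>\<^bsub>R\<^esub>"
  obtains g h where "unique_product_pair G (support r) (support s) g h"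
  using assms ex_unique_product_pair[OF support_subset finite_support _ support_subset finite_support]
    support_nonempty by metis

lemma mult_nonzero:
  assumes r: "r \<in> carrier R" and s: "s \<in> carrier R" and "r \<noteq> \<zero>\<^bsub>R\<^esub>" "s \<noteq> \<zero>\<^bsub>R\<^esub>"
  shows "r \<otimes>\<^bsub>R\<^esub> s \<noteq> \<zero>\<^bsub>R\<^esub>"
proof -
  obtain g h where gh: "unique_product_pair G (support r) (support s) g h"
    using assms by (rule ex_unique_product_pair_supports)
  then have "g \<otimes>\<^bsub>G\<^esub> h \<in> carrier G"
    using support_subset by (auto simp: unique_product_pair_def)
  then show ?thesis
    using component_mult_nonzero[OF r s gh] component_zero by auto
qed

lemma idempotent_trivial:
  assumes e: "e \<in> carrier R" "e \<otimes>\<^bsub>R\<^esub> e = e"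
  shows "e = \<zero>\<^bsub>R\<^esub> \<or> e = \<one>\<^bsub>R\<^esub>"
proof -
  have "e \<otimes>\<^bsub>R\<^esub> (e \<ominus>\<^bsub>R\<^esub> \<one>\<^bsub>R\<^esub>) = \<zero>\<^bsub>R\<^esub>"
    using e by (simp add: R.minus_eq R.r_distr R.r_minus R.r_neg)
  then have "e = \<zero>\<^bsub>R\<^esub> \<or> e \<ominus>\<^bsub>R\<^esub> \<one>\<^bsub>R\<^esub> = \<zero>\<^bsub>R\<^esub>"
    using mult_nonzero e(1) by blast
  then show ?thesis
    using e(1) by simp
qed

text \<open>
  Every uniquely represented product of degrees of \<open>u\<close> and \<open>v\<close> is a degree of \<open>u \<otimes> v = \<one>\<close>, that is,
  equals \<open>\<one>\<close>. So there is only one such product, and both supports are singletons.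
\<close>

lemma homogeneous_if_right_invertible:
  assumes u: "u \<in> carrier R" and v: "v \<in> carrier R" and uv: "u \<otimes>\<^bsub>R\<^esub> v = \<one>\<^bsub>R\<^esub>"
    and one: "\<one>\<^bsub>R\<^esub> \<noteq> \<zero>\<^bsub>R\<^esub>"
  shows "homogeneous G R S u"
proof -
  have "u \<noteq> \<zero>\<^bsub>R\<^esub>" "v \<noteq> \<zero>\<^bsub>R\<^esub>"
    using u v uv one by auto
  then obtain g h where gh: "unique_product_pair G (support u) (support v) g h"
    using ex_unique_product_pair_supports u v by metis
  have prod_one: "a \<otimes>\<^bsub>G\<^esub> b = \<one>\<^bsub>G\<^esub>" if ab: "unique_product_pair G (support u) (support v) a b" for a b
  proof -
    have "a \<otimes>\<^bsub>G\<^esub> b \<in> carrier G"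
      using ab support_subset by (auto simp: unique_product_pair_def)
    then show ?thesis
      using component_mult_nonzero[OF u v ab] component_homogeneous[OF G.one_closed one_in_S_one]
      by (auto simp: uv split: if_splits)
  qed
  have "a = g \<and> b = h" if ab: "unique_product_pair G (support u) (support v) a b" for a b
    using ab gh prod_one[OF ab] prod_one[OF gh] unfolding unique_product_pair_def by metis
  moreover have "g \<in> support u" "h \<in> support v"
    using gh by (auto simp: unique_product_pair_def)
  ultimately have "support u = {g}"
    by (intro lone_unique_product_pair_imp_singletons(1)[OF support_subset finite_support[OF u]
          support_subset finite_support[OF v]])
  then show ?thesis
    by (rule homogeneous_if_support_singleton[OF u])
qed

end

theorem theorem3p4:
  fixes G :: "('g, 'm) monoid_scheme" and R :: "('r, 'n) ring_scheme" and S :: "'g \<Rightarrow> 'r set"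
  assumes "unique_product_group G"
    and "graded_ring G R S"
    and "\<one>\<^bsub>R\<^esub> \<noteq> \<zero>\<^bsub>R\<^esub>"
    and "fully_component_regular G R S"
  shows "(\<forall>u\<in>Units R. homogeneous G R S u)
    \<and> noncomm_domain R
    \<and> (\<forall>e\<in>carrier R. e \<otimes>\<^bsub>R\<^esub> e = e \<longrightarrow> e = \<zero>\<^bsub>R\<^esub> \<or> e = \<one>\<^bsub>R\<^esub>)"
proof -
  interpret fully_component_regular_graded_ring G R S
    using assms(1,2,4)
    by (simp add: fully_component_regular_graded_ring_def
        fully_component_regular_graded_ring_axioms_def)
  have "homogeneous G R S u" if "u \<in> Units R" for u
    using that assms(3) homogeneous_if_right_invertible unfolding Units_def by blast
  moreover have "noncomm_domain R"
  proof
    show "carrier R \<noteq> {\<zero>\<^bsub>R\<^esub>}"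
      using assms(3) R.one_closed by blast
  qed (rule mult_nonzero)
  ultimately show ?thesis
    using idempotent_trivial by blast
qed

end
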